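(* Let $(\mathbf{X}_t)$ be a geometric opinion dynamics (as in the context) that is continuous, i.e., for every fixed $\xi\in\mathbb{S}^{d-1}$ and every $i$, the map $(\mathbf{x}_1,\ldots,\mathbf{x}_n)\mapsto f_i(\mathbf{x}_1,\ldots,\mathbf{x}_n,\xi)$ is continuous on $(\mathbb{S}^{d-1})^n$. Suppose every invariant distribution of the joint chain on $(\mathbb{S}^{d-1})^n$ has support contained in $P$. Then from every starting configuration $\mathbf{X}_0$, $\mathbf{X}_t$ weakly polarizes on average, i.e., for every $\epsilon>0$, $$\lim_{T\to\infty}\frac{1}{T}\mathbb{E}\Big[\sum_{t=1}^T I_{P_\epsilon}(\mathbf{X}_t)\Big]=1,$$ where $P_\epsilon=\{\mathbf{z}\in(\mathbb{S}^{d-1})^n:\rho(\mathbf{z},P)\le\epsilon\}$.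
   Context: Fix $n,d\ge1$. A geometric opinion dynamics is the Markov chain $\mathbf{X}_t=(\mathbf{X}_t^{(1)},\ldots,\mathbf{X}_t^{(n)})$ on $(\mathbb{S}^{d-1})^n$ given by $\mathbf{X}_{t+1}^{(i)}=P_{\mathbb{S}^{d-1}}\big(\mathbf{X}_t^{(i)}+f_i(\mathbf{X}_t^{(1)},\ldots,\mathbf{X}_t^{(n)},\xi_t)\big)$, with $P_{\mathbb{S}^{d-1}}(\mathbf{x})=\mathbf{x}/\|\mathbf{x}\|_2$, $\xi_t\in\mathbb{S}^{d-1}$ i.i.d. from a fixed distribution $\mathcal{D}$ independent of everything else, each $f_i:(\mathbb{S}^{d-1})^{n+1}\to\mathbb{R}^d$ a fixed measurable function, and the unnormalized vector assumed always nonzero. An invariant distribution is a probability measure $\mu$ on $(\mathbb{S}^{d-1})^n$ such that $\mathbf{X}_0\sim\mu$ implies $\mathbf{X}_1\sim\mu$. $P=\{(\sigma_1\mathbf{x},\ldots,\sigma_n\mathbf{x}):\mathbf{x}\in\mathbb{S}^{d-1},\bm{\sigma}\in\{-1,1\}^n\}$, $\rho(\mathbf{z},P)=\inf_{\mathbf{y}\in P}\|\mathbf{z}-\mathbf{y}\|_2$, and $I_{P_\epsilon}$ is the indicator of $P_\epsilon$. *)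

theory Defs
  imports "HOL-Probability.Probability"
begin

text \<open>Configurations: n agents (index type 'n) with opinions on the unit sphere of
  the d-dimensional Euclidean space 'a. A configuration is an element of 'a^'n,
  whose norm is the Euclidean (L2) norm on (R^d)^n.\<close>

definition config_space :: "('a::euclidean_space ^ 'n::finite) set" where
  "config_space = {x. \<forall>i. x $ i \<in> sphere 0 1}"

definition god_step ::
  "('n::finite \<Rightarrow> ('a::euclidean_space ^ 'n) \<Rightarrow> 'a \<Rightarrow> 'a) \<Rightarrow> 'a ^ 'n \<Rightarrow> 'a \<Rightarrow> 'a ^ 'n" where
  "god_step f x \<xi> = (\<chi> i. (x $ i + f i x \<xi>) /\<^sub>R norm (x $ i + f i x \<xi>))"

primrec god_traj ::
  "('n::finite \<Rightarrow> ('a::euclidean_space ^ 'n) \<Rightarrow> 'a \<Rightarrow> 'a) \<Rightarrow> 'a ^ 'n \<Rightarrow> nat \<Rightarrow> (nat \<Rightarrow> 'a) \<Rightarrow> 'a ^ 'n" where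
  "god_traj f x0 0 \<omega> = x0"
| "god_traj f x0 (Suc t) \<omega> = god_step f (god_traj f x0 t \<omega>) (\<omega> t)"

definition god_invariant ::
  "('n::finite \<Rightarrow> ('a::euclidean_space ^ 'n) \<Rightarrow> 'a \<Rightarrow> 'a) \<Rightarrow> 'a measure \<Rightarrow> ('a ^ 'n) measure \<Rightarrow> bool" where
  "god_invariant f D \<mu> \<longleftrightarrow> prob_space \<mu> \<and> sets \<mu> = sets borel \<and> emeasure \<mu> config_space = 1 \<and>
     distr (\<mu> \<Otimes>\<^sub>M D) borel (\<lambda>(x, \<xi>). god_step f x \<xi>) = \<mu>"

definition measure_support :: "('b::metric_space) measure \<Rightarrow> 'b set" where
  "measure_support \<mu> = {z. \<forall>e>0. emeasure \<mu> (ball z e) > 0}"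

definition polarized :: "('a::euclidean_space ^ 'n::finite) set" where
  "polarized = {(\<chi> i. \<sigma> i *\<^sub>R x) | x \<sigma>. x \<in> sphere 0 1 \<and> (\<forall>i. \<sigma> i \<in> {-1, 1})}"

definition polarized_eps :: "real \<Rightarrow> ('a::euclidean_space ^ 'n::finite) set" where
  "polarized_eps \<epsilon> = {z \<in> config_space. infdist z polarized \<le> \<epsilon>}"

end

theory Submission
  imports Defs
begin

text \<open>This is the Krylov--Bogoliubov argument. If the time averages did not converge to 1, some
  subsequence of the averaged laws of the chain would stay away from polarization. By compactness a
  further subsequence converges weakly, and continuity of the dynamics (the Feller property) makes
  the limit an invariant distribution. It is therefore carried by the polarized set, and testing weak
  convergence against the continuous function \<open>min 1 (\<rho>(z, P) / \<epsilon>)\<close> gives a contradiction.\<close>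

section \<open>Coding bounded sets by real numbers\<close>

text \<open>The work lies in selecting a weakly convergent subsequence. Helly's theorem selects
  through distribution functions and so lives on the real line. The way around is a continuous curve
  \<open>G\<close> with a Borel right inverse \<open>s\<close> on the compact set: \<open>s\<close>
  pushes the measures to the line, where its discontinuities do no harm, and \<open>G\<close> pushes
  the limit back, its continuity keeping test functions continuous. Schoenberg's curve suits this
  because its right inverse is an explicit digit formula, so measurability is immediate. A second
  gap is that weak convergence asks for test functions continuous on the whole space, while the
  dynamics is continuous only on the configuration space and for noise on the sphere. Tietze
  extension and almost-everywhere statements bridge it.\<close>

definition schoenberg_wave :: "real \<Rightarrow> real" where
  "schoenberg_wave t = max 0 (min 1 ((1 - 2 * cos (pi * t)) / 2))"

text \<open>Digits 0 and 1 become ternary digits 0 and 2, so the code is a point of the Cantor set;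
  the gaps leave the wave room to climb from 0 to 1.\<close>

definition cantor_code :: "(nat \<Rightarrow> real) \<Rightarrow> real" where
  "cantor_code a = (\<Sum>n. 2 * a n / 3 ^ Suc n)"

definition binary_digit :: "nat \<Rightarrow> real \<Rightarrow> real" where
  "binary_digit k u = of_int (\<lfloor>2 ^ Suc k * u\<rfloor> - 2 * \<lfloor>2 ^ k * u\<rfloor>)"

lemma schoenberg_wave_bounds: "0 \<le> schoenberg_wave t" "schoenberg_wave t \<le> 1"
  by (auto simp: schoenberg_wave_def)

lemma schoenberg_wave_add_even: "schoenberg_wave (2 * of_nat m + t) = schoenberg_wave t"
proof -
  have "cos (pi * (2 * real m + t)) = cos (pi * t + real m * (2 * pi))"
    by (simp add: algebra_simps)
  also have "\<dots> = cos (pi * t)"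
    by (induction m) (simp_all add: ring_distribs add.assoc[symmetric] cos_add)
  finally show ?thesis by (simp add: schoenberg_wave_def)
qed

text \<open>Clipping creates the plateaus: the unclipped value passes 0 at 1/3 and 1 at 2/3, the
  ends of the middle third that the Cantor set omits. A cosine makes continuity and period 2
  immediate.\<close>

lemma schoenberg_wave_eq_0:
  assumes "0 \<le> t" "t \<le> 1/3"
  shows "schoenberg_wave t = 0"
proof -
  have "cos (pi / 3) \<le> cos (pi * t)"
    using assms by (intro cos_monotone_0_pi_le) (auto simp: field_simps)
  thus ?thesis by (simp add: schoenberg_wave_def cos_60)
qed

lemma schoenberg_wave_eq_1:
  assumes "2/3 \<le> t" "t \<le> 1"
  shows "schoenberg_wave t = 1"
proof -
  have "cos (pi * t) \<le> cos (pi - pi / 3)"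
    using assms by (intro cos_monotone_0_pi_le) (auto simp: field_simps)
  moreover have "cos (pi - pi / 3) = - (1/2)"
    unfolding cos_diff by (simp add: cos_60)
  ultimately show ?thesis by (simp add: schoenberg_wave_def)
qed

lemma cantor_code_summable:
  assumes "\<And>n. a n \<in> {0, 1::real}"
  shows "summable (\<lambda>n. 2 * a n / 3 ^ Suc n)"
proof (rule summable_comparison_test')
  show "summable (\<lambda>n. (2/3) * (1 / 3) ^ n :: real)" by (intro summable_mult summable_geometric) simp
  show "norm (2 * a n / 3 ^ Suc n) \<le> (2/3) * (1 / 3) ^ n" if "n \<ge> 0" for n
    using assms[of n] by (auto simp: field_simps)
qed

lemma cantor_code_bounds:
  assumes "\<And>n. a n \<in> {0, 1::real}"
  shows "0 \<le> cantor_code a" "cantor_code a \<le> 1"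
proof -
  have "0 \<le> 2 * a n / 3 ^ Suc n" for n using assms[of n] by auto
  thus "0 \<le> cantor_code a"
    unfolding cantor_code_def by (intro suminf_nonneg cantor_code_summable assms)
  have "(\<lambda>n. (2/3) * (1 / 3) ^ n :: real) sums ((2/3) * (1 / (1 - 1/3)))"
    by (intro sums_mult geometric_sums) simp
  hence s: "(\<lambda>n. (2/3) * (1 / 3) ^ n :: real) sums 1" by simp
  have "2 * a n / 3 ^ Suc n \<le> (2/3) * (1 / 3) ^ n" for n
    using assms[of n] by (auto simp: field_simps)
  hence "cantor_code a \<le> (\<Sum>n. (2/3) * (1 / 3) ^ n)"
    unfolding cantor_code_def
    by (intro suminf_le cantor_code_summable[OF assms] sums_summable[OF s])
  thus "cantor_code a \<le> 1"
    using sums_unique[OF s] by linarith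
qed

text \<open>Multiplying by 3 moves the ternary point one place. As the remaining code lies in
  [0, 1], the code itself lies in [0, 1/3] or [2/3, 1] according to \<open>a 0\<close>, exactly the
  plateaus of the wave.\<close>

lemma cantor_code_shift:
  assumes "\<And>n. a n \<in> {0, 1::real}"
  shows "3 * cantor_code a = 2 * a 0 + cantor_code (\<lambda>n. a (Suc n))"
proof -
  have "cantor_code (\<lambda>n. a (Suc n)) / 3 = (\<Sum>n. (2 * a (Suc n) / 3 ^ Suc n) / 3)"
    unfolding cantor_code_def
    using cantor_code_summable[of "\<lambda>n. a (Suc n)"] assms by (intro suminf_divide[symmetric]) auto
  also have "\<dots> = (\<Sum>n. 2 * a (Suc n) / 3 ^ Suc (Suc n))"
    by (intro arg_cong[of _ _ suminf] ext) (simp add: field_simps)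
  also have "\<dots> = cantor_code a - 2 * a 0 / 3 ^ Suc 0"
    unfolding cantor_code_def by (rule suminf_split_head[OF cantor_code_summable[of a, OF assms]])
  finally show ?thesis by simp
qed

text \<open>Each factor 3 splits off an even integer, invisible to a function of period 2, and
  leaves the code of the shifted sequence; finally the leading digit selects the plateau.\<close>

lemma schoenberg_wave_cantor_code:
  assumes "\<And>n. a n \<in> {0, 1::real}"
  shows "schoenberg_wave (3 ^ n * cantor_code a) = a n"
  using assms
proof (induction n arbitrary: a)
  case 0
  have "0 \<le> cantor_code (\<lambda>n. a (Suc n))" "cantor_code (\<lambda>n. a (Suc n)) \<le> 1"
    using cantor_code_bounds[of "\<lambda>n. a (Suc n)"] 0 by auto
  moreover note cantor_code_shift[of a, OF 0]
  ultimately show ?case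
    using 0[of 0] schoenberg_wave_eq_0[of "cantor_code a"] schoenberg_wave_eq_1[of "cantor_code a"]
    by auto
next
  case (Suc n)
  have "3 ^ Suc n * cantor_code a = 3 ^ n * (3 * cantor_code a)" by simp
  \<comment> \<open>The \<open>if\<close> is \<open>3 ^ n * a 0\<close> written as a natural number,
    the form that \<open>schoenberg_wave_add_even\<close> takes.\<close>
  also have "\<dots> = 2 * of_nat (if a 0 = 0 then 0 else 3 ^ n) + 3 ^ n * cantor_code (\<lambda>n. a (Suc n))"
    unfolding cantor_code_shift[of a, OF Suc.prems] using Suc.prems[of 0] by (auto simp: ring_distribs)
  finally have "schoenberg_wave (3 ^ Suc n * cantor_code a) =
    schoenberg_wave (2 * of_nat (if a 0 = 0 then 0 else 3 ^ n) + 3 ^ n * cantor_code (\<lambda>n. a (Suc n)))"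
    by (rule arg_cong)
  also have "\<dots> = a (Suc n)"
    unfolding schoenberg_wave_add_even using Suc.IH[of "\<lambda>n. a (Suc n)"] Suc.prems by auto
  finally show ?case .
qed

lemma binary_digit_01: "binary_digit k u \<in> {0, 1}"
proof -
  have "\<lfloor>2 ^ Suc k * u\<rfloor> - 2 * \<lfloor>2 ^ k * u\<rfloor> \<in> {0, 1}"
    by (simp add: mult.assoc) linarith
  thus ?thesis unfolding binary_digit_def by fastforce
qed

lemma binary_digit_measurable [measurable]: "binary_digit k \<in> borel_measurable borel"
  unfolding binary_digit_def by measurable

text \<open>The partial sums telescope to the truncations \<open>F n\<close>, which are within
  \<open>(1/2) ^ n\<close> of \<open>u\<close>; the range of \<open>u\<close> makes the integer part
  \<open>F 0\<close> vanish.\<close>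

lemma binary_digit_sums:
  assumes "0 \<le> u" "u < 1"
  shows "(\<lambda>k. binary_digit k u / 2 ^ Suc k) sums u"
proof -
  define F where "F k = of_int \<lfloor>2 ^ k * u\<rfloor> / (2 ^ k :: real)" for k
  have "F \<longlonglongrightarrow> u"
  proof (rule tendsto_sandwich)
    show "\<forall>\<^sub>F k in sequentially. u - (1/2) ^ k \<le> F k"
    proof (rule always_eventually, rule allI)
      fix k
      have "2 ^ k * u - 1 \<le> of_int \<lfloor>2 ^ k * u\<rfloor>" by linarith
      hence "(2 ^ k * u - 1) / 2 ^ k \<le> F k" unfolding F_def by (intro divide_right_mono) auto
      thus "u - (1/2) ^ k \<le> F k" by (simp add: field_simps)
    qed
    show "\<forall>\<^sub>F k in sequentially. F k \<le> u"
    proof (rule always_eventually, rule allI)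
      fix k
      have "F k \<le> (2 ^ k * u) / 2 ^ k" unfolding F_def by (intro divide_right_mono) auto
      thus "F k \<le> u" by simp
    qed
    have "(\<lambda>k. u - (1/2) ^ k) \<longlonglongrightarrow> u - 0"
      by (intro tendsto_intros LIMSEQ_power_zero) simp
    thus "(\<lambda>k. u - (1/2) ^ k) \<longlonglongrightarrow> u" by simp
  qed auto
  hence "(\<lambda>k. F (Suc k) - F k) sums (u - F 0)" by (rule telescope_sums)
  moreover have "F 0 = 0" using assms by (simp add: F_def floor_eq_iff)
  moreover have "F (Suc k) - F k = binary_digit k u / 2 ^ Suc k" for k
    by (simp add: F_def binary_digit_def field_simps)
  ultimately show ?thesis by simp
qed

lemma schoenberg_series_continuous:
  fixes N :: "nat \<Rightarrow> nat"
  shows "continuous_on UNIV (\<lambda>t. \<Sum>k. schoenberg_wave (3 ^ N k * t) / 2 ^ Suc k)"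
proof (rule uniform_limit_theorem)
  have wc: "continuous_on UNIV schoenberg_wave"
    unfolding schoenberg_wave_def by (intro continuous_intros) auto
  show "\<forall>\<^sub>F n in sequentially.
      continuous_on UNIV (\<lambda>t. \<Sum>k<n. schoenberg_wave (3 ^ N k * t) / 2 ^ Suc k)"
    by (intro always_eventually allI continuous_intros continuous_on_compose2[OF wc]) auto
  show "uniform_limit UNIV (\<lambda>n t. \<Sum>k<n. schoenberg_wave (3 ^ N k * t) / 2 ^ Suc k)
     (\<lambda>t. \<Sum>k. schoenberg_wave (3 ^ N k * t) / 2 ^ Suc k) sequentially"
  proof (rule Weierstrass_m_test)
    show "norm (schoenberg_wave (3 ^ N k * t) / 2 ^ Suc k) \<le> (1/2) ^ Suc k" for k t
      using schoenberg_wave_bounds[of "3 ^ N k * t"] by (simp add: field_simps)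
    show "summable (\<lambda>k. (1/2) ^ Suc k :: real)"
      by (subst summable_Suc_iff) (simp add: summable_geometric)
  qed
qed auto

text \<open>Schoenberg's space-filling curve: interleaving the binary digits of the coordinates of a point
  into the ternary digits of one real number gives a Borel right inverse.\<close>

lemma bounded_set_curve_section:
  fixes K :: "'b::euclidean_space set"
  assumes "bounded K"
  obtains s :: "'b \<Rightarrow> real" and G :: "real \<Rightarrow> 'b"
  where "s \<in> borel_measurable borel" "continuous_on UNIV G"
    "\<And>x. s x \<in> {0..1}" "\<And>x. x \<in> K \<Longrightarrow> G (s x) = x"
proof -
  obtain B where B: "B > 0" "\<And>x. x \<in> K \<Longrightarrow> norm x \<le> B"
    using assms bounded_pos by blast
  obtain m and e :: "nat \<Rightarrow> 'b" where e: "bij_betw e {..<m} Basis"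
    using ex_bij_betw_nat_finite[OF finite_Basis] by (metis atLeast0LessThan)
  \<comment> \<open>The denominator 2 * B + 1, rather than 2 * B, keeps rescaled coordinates of
    points of \<open>K\<close> strictly below 1, as the digit expansion requires.\<close>
  define u where "u j x = (x \<bullet> e j + B) / (2 * B + 1)" for j x
  \<comment> \<open>Position \<open>m * k + j\<close> holds digit \<open>k\<close> of coordinate
    \<open>j\<close>, which is why \<open>g j\<close> reads the positions
    \<open>m * k + j\<close>.\<close>
  define a where "a x n = binary_digit (n div m) (u (n mod m) x)" for x n
  define s where "s x = cantor_code (a x)" for x
  define g where "g j t = (\<Sum>k. schoenberg_wave (3 ^ (m * k + j) * t) / 2 ^ Suc k)" for j t
  define G where "G t = (\<Sum>j<m. ((2 * B + 1) * g j t - B) *\<^sub>R e j)" for t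
  have a01: "a x n \<in> {0, 1}" for x n unfolding a_def by (rule binary_digit_01)
  show thesis
  proof
    show "s \<in> borel_measurable borel"
      unfolding s_def cantor_code_def a_def u_def by measurable
    show "continuous_on UNIV G"
      unfolding G_def g_def by (intro continuous_intros schoenberg_series_continuous)
    \<comment> \<open>Membership in \<open>K\<close> is not assumed: \<open>binary_digit\<close> is
      0 or 1 at every real number, also outside the unit interval.\<close>
    show "s x \<in> {0..1}" for x
      using cantor_code_bounds[OF a01] by (simp add: s_def)
    show "G (s x) = x" if x: "x \<in> K" for x
    proof -
      have "g j (s x) = u j x" if j: "j < m" for j
      proof -
        have "schoenberg_wave (3 ^ (m * k + j) * s x) = binary_digit k (u j x)" for k
          unfolding s_def schoenberg_wave_cantor_code[OF a01] using j by (simp add: a_def)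
        moreover have "0 \<le> u j x" "u j x < 1"
        proof -
          have "e j \<in> Basis" using e j by (auto simp: bij_betw_def)
          hence "\<bar>x \<bullet> e j\<bar> \<le> B" using Basis_le_norm[of "e j" x] B(2)[OF x] by linarith
          thus "0 \<le> u j x" "u j x < 1" using B(1) by (auto simp: u_def field_simps)
        qed
        ultimately show ?thesis
          using sums_unique[OF binary_digit_sums, of "u j x"] by (simp add: g_def)
      qed
      hence "G (s x) = (\<Sum>j<m. (x \<bullet> e j) *\<^sub>R e j)"
        unfolding G_def using B(1) by (intro sum.cong) (auto simp: u_def)
      also have "\<dots> = (\<Sum>b\<in>Basis. (x \<bullet> b) *\<^sub>R b)"
        by (rule sum.reindex_bij_betw[OF e])
      finally show ?thesis by (simp add: euclidean_representation)
    qed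
  qed
qed

section \<open>Weak limits of measures on a compact set\<close>

text \<open>Truncated multiples of the distance approximate the indicator of a closed set, and
  closed sets are an intersection-stable generator of the Borel sets.\<close>

lemma measure_eqI_continuous:
  fixes M N :: "'b::metric_space measure"
  assumes "prob_space M" "prob_space N" and sets [measurable_cong]: "sets M = sets borel" "sets N = sets borel"
    and eq: "\<And>h :: 'b \<Rightarrow> real. continuous_on UNIV h \<Longrightarrow> (\<And>x. h x \<in> {0..1}) \<Longrightarrow>
      integral\<^sup>L M h = integral\<^sup>L N h"
  shows "M = N"
proof -
  interpret M: prob_space M by fact
  interpret N: prob_space N by fact
  have closed_eq: "emeasure M C = emeasure N C" if "closed C" for C
  \<comment> \<open>\<open>infdist\<close> to the empty set is 0 by convention, which would make
    every \<open>h n\<close> constantly 1.\<close>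
  proof (cases "C = {}")
    case False
    define h where "h n x = max 0 (1 - real n * infdist x C)" for n x
    have h01: "h n x \<in> {0..1}" for n x
      using infdist_nonneg[of x C] by (auto simp: h_def)
    have hc: "continuous_on UNIV (h n)" for n
      unfolding h_def by (intro continuous_intros)
    hence [measurable]: "h n \<in> borel_measurable borel" for n
      by (rule borel_measurable_continuous_onI)
    have lim: "(\<lambda>n. h n x) \<longlonglongrightarrow> indicat_real C x" for x
    proof (cases "x \<in> C")
      case True
      thus ?thesis by (simp add: h_def)
    next
      case out: False
      hence pos: "infdist x C > 0"
        using that False in_closed_iff_infdist_zero infdist_nonneg[of x C] by (metis less_eq_real_def)
      obtain m where m: "1 < real m * infdist x C" using reals_Archimedean3[OF pos] by blast
      have "h n x = indicat_real C x" if "n \<ge> m" for n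
      proof -
        have "real m * infdist x C \<le> real n * infdist x C"
          using that pos by (intro mult_right_mono) auto
        thus ?thesis using m out by (simp add: h_def)
      qed
      thus ?thesis by (intro tendsto_eventually eventually_sequentiallyI[of m])
    qed
    have C: "C \<in> sets borel" using that by (rule borel_closed)
    have conv: "(\<lambda>n. integral\<^sup>L P (h n)) \<longlonglongrightarrow> measure P C"
      if "prob_space P" and [measurable_cong]: "sets P = sets borel" for P
    proof -
      interpret P: prob_space P by fact
      have "(\<lambda>n. integral\<^sup>L P (h n)) \<longlonglongrightarrow> integral\<^sup>L P (indicat_real C)"
        using h01 C lim by (intro integral_dominated_convergence[where w = "\<lambda>_. 1"]) auto
      thus ?thesis
        using C sets_eq_imp_space_eq[OF that(2)] by simp
    qed
    have "measure M C = measure N C"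
      using conv[OF assms(1) sets(1)] conv[OF assms(2) sets(2)] eq[OF hc h01] LIMSEQ_unique by simp
    thus ?thesis by (simp add: M.emeasure_eq_measure N.emeasure_eq_measure)
  qed simp
  show ?thesis
  proof (rule measure_eqI_generator_eq[where E = "Collect closed" and \<Omega> = UNIV and A = "\<lambda>_. UNIV"])
    show "Int_stable (Collect closed :: 'b set set)" by (auto simp: Int_stable_def)
  qed (use closed_eq sets in \<open>auto simp: borel_eq_closed\<close>)
qed

text \<open>The curve transports Helly's selection theorem from the real line to several dimensions.\<close>

lemma compact_weakly_convergent_subseq:
  fixes \<nu> :: "nat \<Rightarrow> 'b::euclidean_space measure"
  assumes K: "compact K" and prob: "\<And>n. prob_space (\<nu> n)"
    and sets [measurable_cong]: "\<And>n. sets (\<nu> n) = sets borel"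
    and supp: "\<And>n. AE x in \<nu> n. x \<in> K"
  obtains r \<mu> where "strict_mono (r :: nat \<Rightarrow> nat)" "prob_space \<mu>" "sets \<mu> = sets borel"
    "AE x in \<mu>. x \<in> K"
    "\<And>(h :: 'b \<Rightarrow> real) B. continuous_on UNIV h \<Longrightarrow> (\<And>x. \<bar>h x\<bar> \<le> B) \<Longrightarrow>
       (\<lambda>n. integral\<^sup>L (\<nu> (r n)) h) \<longlonglongrightarrow> integral\<^sup>L \<mu> h"
proof -
  obtain s :: "'b \<Rightarrow> real" and G :: "real \<Rightarrow> 'b" where [measurable]: "s \<in> borel_measurable borel"
    and G: "continuous_on UNIV G" and s01: "\<And>x. s x \<in> {0..1}" and Gs: "\<And>x. x \<in> K \<Longrightarrow> G (s x) = x"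
    using bounded_set_curve_section[OF compact_imp_bounded[OF K]] by blast
  have [measurable]: "G \<in> borel_measurable borel" using G by (rule borel_measurable_continuous_onI)
  define R where "R n = distr (\<nu> n) borel s" for n
  have R: "real_distribution (R n)" for n
    unfolding R_def real_distribution_def real_distribution_axioms_def
    by (auto intro!: prob_space.prob_space_distr prob)
  \<comment> \<open>Tightness is phrased with half-open intervals; the left end -1 admits the
    possible value 0 of \<open>s\<close>.\<close>
  have mass: "measure (R n) {-1<..1} = 1" for n
  proof -
    have "s x \<in> {-1<..1}" for x using s01[of x] by auto
    hence "s -` {-1<..1} = UNIV" by blast
    thus ?thesis
      unfolding R_def using prob_space.prob_space[OF prob] by (simp add: measure_distr)
  qed
  have "tight R"
    unfolding tight_def
    by (intro conjI allI impI R exI[of _ "-1"] exI[of _ 1]) (auto simp: mass)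
  from tight_imp_convergent_subsubsequence[OF this strict_mono_id] obtain r R' where r: "strict_mono r" and R': "real_distribution R'" and
    conv: "weak_conv_m (R \<circ> r) R'"
    by auto
  interpret R': real_distribution R' by fact
  define \<mu> where "\<mu> = distr R' borel G"
  have \<mu>: "prob_space \<mu>" unfolding \<mu>_def by (intro R'.prob_space_distr) simp
  interpret \<mu>: prob_space \<mu> by fact
  have lim: "(\<lambda>n. integral\<^sup>L (\<nu> (r n)) h) \<longlonglongrightarrow> integral\<^sup>L \<mu> h"
    if h: "continuous_on UNIV h" and B: "\<And>x. \<bar>h x\<bar> \<le> B" for h :: "'b \<Rightarrow> real" and B
  proof -
    have [measurable]: "h \<in> borel_measurable borel" using h by (rule borel_measurable_continuous_onI)
    have cont: "continuous_on UNIV (\<lambda>t. h (G t))" using h G by (rule continuous_on_compose2) auto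
    have "(\<lambda>n. integral\<^sup>L ((R \<circ> r) n) (\<lambda>t. h (G t))) \<longlonglongrightarrow> integral\<^sup>L R' (\<lambda>t. h (G t))"
      using cont B conv R R'
      by (intro weak_conv_imp_integral_bdd_continuous_conv[where B = B])
         (auto simp: continuous_on_eq_continuous_at o_def)
    moreover have "integral\<^sup>L (R n) (\<lambda>t. h (G t)) = integral\<^sup>L (\<nu> n) h" for n
    proof -
      have "integral\<^sup>L (R n) (\<lambda>t. h (G t)) = (\<integral>x. h (G (s x)) \<partial>\<nu> n)"
        unfolding R_def by (rule integral_distr) simp_all
      also have "\<dots> = integral\<^sup>L (\<nu> n) h"
        using supp[of n] Gs by (intro integral_cong_AE) auto
      finally show ?thesis .
    qed
    moreover have "integral\<^sup>L \<mu> h = integral\<^sup>L R' (\<lambda>t. h (G t))"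
      unfolding \<mu>_def by (rule integral_distr) simp_all
    ultimately show ?thesis by simp
  qed
  \<comment> \<open>Nothing places \<open>R'\<close> on the range of \<open>s\<close>, so
    \<open>G\<close> might carry mass outside \<open>K\<close>. Testing the limit with the truncated
    distance to \<open>K\<close> excludes this.\<close>
  have "AE x in \<mu>. x \<in> K"
  proof -
    define h where "h x = min 1 (infdist x K)" for x
    have hc: "continuous_on UNIV h" unfolding h_def by (intro continuous_intros)
    have hb: "\<bar>h x\<bar> \<le> 1" for x using infdist_nonneg[of x K] by (auto simp: h_def)
    have [measurable]: "h \<in> borel_measurable borel" using hc by (rule borel_measurable_continuous_onI)
    have "K \<noteq> {}"
      using prob_space.prob_space[OF prob] supp prob_space.AE_False[OF prob] by auto
    have "integral\<^sup>L (\<nu> n) h = (\<integral>x. 0 \<partial>\<nu> n)" for n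
      using supp[of n] by (intro integral_cong_AE) (auto simp: h_def)
    hence "(\<lambda>n. 0) \<longlonglongrightarrow> integral\<^sup>L \<mu> h" using lim[OF hc hb] by simp
    hence "integral\<^sup>L \<mu> h = 0" using LIMSEQ_unique[OF tendsto_const] by metis
    moreover have "integrable \<mu> h"
      using hb by (intro \<mu>.integrable_const_bound[where B = 1]) (auto simp: \<mu>_def)
    ultimately have "AE x in \<mu>. h x = 0"
      using infdist_nonneg by (subst (asm) integral_nonneg_eq_0_iff_AE) (auto simp: h_def)
    thus ?thesis
    proof eventually_elim
      case (elim x)
      thus ?case
        using in_closed_iff_infdist_zero[OF compact_imp_closed[OF K] \<open>K \<noteq> {}\<close>]
        by (auto simp: h_def min_def split: if_splits)
    qed
  qed
  show thesis by (rule that[OF r \<mu> _ \<open>AE x in \<mu>. x \<in> K\<close> lim]) (simp_all add: \<mu>_def)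
qed

text \<open>A point outside the support has a null ball around it, and by Lindelof countably many
  null open sets already cover all of these.\<close>

lemma AE_measure_support:
  fixes \<mu> :: "'b::{metric_space, second_countable_topology} measure"
  assumes [measurable_cong]: "sets \<mu> = sets borel"
  shows "AE x in \<mu>. x \<in> measure_support \<mu>"
proof -
  define F where "F = {U. open U \<and> emeasure \<mu> U = 0}"
  obtain F' where F': "F' \<subseteq> F" "countable F'" "\<Union>F' = \<Union>F"
    using Lindelof[of F] by (auto simp: F_def)
  have "(\<Union>U\<in>F'. U) \<in> null_sets \<mu>"
    using F'(1,2) by (intro null_sets_UN') (auto simp: F_def null_sets_def assms)
  moreover have "{x \<in> space \<mu>. x \<notin> measure_support \<mu>} \<subseteq> \<Union>F"
    unfolding F_def measure_support_def by (fastforce simp: not_gr_zero intro: centre_in_ball[THEN iffD2])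
  ultimately show ?thesis using F'(3) by (intro AE_I'[of "\<Union>F'"]) auto
qed

text \<open>The average is the law at a uniformly random time, so facts about \<open>bind\<close>
  apply. At \<open>T = 0\<close> the pmf is unspecified but still a probability measure; only the
  integral formula needs \<open>T > 0\<close>.\<close>

definition cesaro_measure :: "(nat \<Rightarrow> 'b::topological_space measure) \<Rightarrow> nat \<Rightarrow> 'b measure" where
  "cesaro_measure M T = measure_pmf (pmf_of_set {1..T}) \<bind> M"

context
  fixes M :: "nat \<Rightarrow> 'b::topological_space measure"
  assumes prob: "\<And>t. prob_space (M t)" and sets: "\<And>t. sets (M t) = sets borel"
begin

lemma cesaro_kernel [measurable]: "M \<in> measurable (measure_pmf p) (subprob_algebra borel)"
proof -
  have "M t \<in> space (subprob_algebra borel)" for t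
    using prob_space_imp_subprob_space[OF prob] sets by (simp add: space_subprob_algebra)
  thus ?thesis by simp
qed

lemma sets_cesaro_measure: "sets (cesaro_measure M T) = sets borel"
  unfolding cesaro_measure_def by (rule sets_bind) (auto simp: sets)

lemma prob_space_cesaro_measure: "prob_space (cesaro_measure M T)"
  unfolding cesaro_measure_def
  by (rule measure_pmf.prob_space_bind[OF _ cesaro_kernel]) (simp add: prob)

lemma AE_cesaro_measure:
  assumes "\<And>t. AE x in M t. P x" and [measurable]: "Measurable.pred borel P"
  shows "AE x in cesaro_measure M T. P x"
  unfolding cesaro_measure_def
  by (subst AE_bind[OF cesaro_kernel]) (auto simp: assms(1))

lemma integral_cesaro_measure:
  fixes h :: "'b \<Rightarrow> real"
  assumes [measurable]: "h \<in> borel_measurable borel" and B: "\<And>x. \<bar>h x\<bar> \<le> B" and T: "T > 0"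
  shows "integral\<^sup>L (cesaro_measure M T) h = (\<Sum>t=1..T. integral\<^sup>L (M t) h) / real T"
proof -
  have "integral\<^sup>L (cesaro_measure M T) h = (\<integral>t. integral\<^sup>L (M t) h \<partial>measure_pmf (pmf_of_set {1..T}))"
    unfolding cesaro_measure_def
    using prob by (intro integral_bind[where K = borel and B = B and B' = 1] cesaro_kernel)
      (auto simp: B prob_space.emeasure_space_1 measure_pmf.finite_measure_axioms)
  also have "\<dots> = (\<Sum>t=1..T. integral\<^sup>L (M t) h) / real T"
    using T by (subst integral_pmf_of_set) auto
  finally show ?thesis .
qed

end

section \<open>Invariant limits of time averages\<close>

lemma (in prob_space) abs_expectation_le:
  fixes g :: "'a \<Rightarrow> real"
  assumes "g \<in> borel_measurable M" "\<And>x. \<bar>g x\<bar> \<le> B"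
  shows "\<bar>expectation g\<bar> \<le> B"
proof -
  have "integrable M g" using assms by (intro integrable_const_bound[where B = B]) auto
  hence "expectation (\<lambda>x. \<bar>g x\<bar>) \<le> B" using assms(2) by (intro integral_le_const) auto
  thus ?thesis using integral_abs_bound[of M g] by linarith
qed

text \<open>Fubini moves one step of the chain from the measure to the test function.\<close>

lemma integral_distr_step:
  fixes h :: "'b::{metric_space, second_countable_topology} \<Rightarrow> real" and \<Phi> :: "'b \<Rightarrow> 'c \<Rightarrow> 'b"
  assumes "prob_space M" "prob_space D" and [measurable_cong]: "sets M = sets borel"
    and [measurable]: "(\<lambda>(x, \<xi>). \<Phi> x \<xi>) \<in> borel_measurable (borel \<Otimes>\<^sub>M D)" "h \<in> borel_measurable borel"
    and B: "\<And>x. \<bar>h x\<bar> \<le> B"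
  shows "integral\<^sup>L (distr (M \<Otimes>\<^sub>M D) borel (\<lambda>(x, \<xi>). \<Phi> x \<xi>)) h = (\<integral>x. (\<integral>\<xi>. h (\<Phi> x \<xi>) \<partial>D) \<partial>M)"
proof -
  interpret M: prob_space M by fact
  interpret D: prob_space D by fact
  interpret P: pair_prob_space M D ..
  have "integrable (M \<Otimes>\<^sub>M D) (\<lambda>(x, \<xi>). h (\<Phi> x \<xi>))"
    using B by (intro P.integrable_const_bound[where B = B]) auto
  from P.integral_fst'[OF this] show ?thesis
    by (subst integral_distr) (auto simp: case_prod_unfold)
qed

text \<open>Averaging the one-step expectation of \<open>h\<close> shifts the time index by one,
  which changes a time average only by its two end terms over \<open>T\<close>. The times
  \<open>s\<close> are prescribed so that the limit can be taken along a subsequence chosen for a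
  contradiction.\<close>

lemma krylov_bogoliubov:
  fixes \<Phi> :: "'b::euclidean_space \<Rightarrow> 'c \<Rightarrow> 'b" and law :: "nat \<Rightarrow> 'b measure" and s :: "nat \<Rightarrow> nat"
  assumes K: "compact K" and D: "prob_space D"
    and \<Phi> [measurable]: "(\<lambda>(x, \<xi>). \<Phi> x \<xi>) \<in> borel_measurable (borel \<Otimes>\<^sub>M D)"
    and cont: "AE \<xi> in D. continuous_on K (\<lambda>x. \<Phi> x \<xi>)"
    and law: "\<And>t. prob_space (law t)" and sets_law [measurable_cong]: "\<And>t. sets (law t) = sets borel"
    and law_K: "\<And>t. AE x in law t. x \<in> K"
    and law_Suc: "\<And>t. law (Suc t) = distr (law t \<Otimes>\<^sub>M D) borel (\<lambda>(x, \<xi>). \<Phi> x \<xi>)"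
    and s: "strict_mono s"
  obtains r \<mu> where "strict_mono (r :: nat \<Rightarrow> nat)" "prob_space \<mu>" "sets \<mu> = sets borel"
    "AE x in \<mu>. x \<in> K" "distr (\<mu> \<Otimes>\<^sub>M D) borel (\<lambda>(x, \<xi>). \<Phi> x \<xi>) = \<mu>"
    "\<And>(h :: 'b \<Rightarrow> real) B. continuous_on UNIV h \<Longrightarrow> (\<And>x. \<bar>h x\<bar> \<le> B) \<Longrightarrow>
       (\<lambda>n. (\<Sum>t=1..s (r n). integral\<^sup>L (law t) h) / real (s (r n))) \<longlonglongrightarrow> integral\<^sup>L \<mu> h"
proof -
  have [measurable]: "K \<in> sets borel" using K by (intro borel_closed compact_imp_closed)
  have cesaro_K: "AE x in cesaro_measure law T. x \<in> K" for T
    by (rule AE_cesaro_measure[OF law sets_law law_K]) simp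
  obtain r \<mu> where r: "strict_mono r" and \<mu>: "prob_space \<mu>" and sets_\<mu> [measurable_cong]: "sets \<mu> = sets borel"
    and \<mu>_K: "AE x in \<mu>. x \<in> K"
    and conv: "\<And>(h :: 'b \<Rightarrow> real) B. continuous_on UNIV h \<Longrightarrow> (\<And>x. \<bar>h x\<bar> \<le> B) \<Longrightarrow>
       (\<lambda>n. integral\<^sup>L (cesaro_measure law (s (r n))) h) \<longlonglongrightarrow> integral\<^sup>L \<mu> h"
    using compact_weakly_convergent_subseq[of K "\<lambda>n. cesaro_measure law (s n)",
        OF K prob_space_cesaro_measure[OF law sets_law] sets_cesaro_measure[OF law sets_law] cesaro_K] by blast
  interpret D: prob_space D by fact
  interpret \<mu>: prob_space \<mu> by fact
  interpret P: pair_prob_space \<mu> D ..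
  define \<tau> where "\<tau> n = s (r n)" for n
  have \<tau>: "strict_mono \<tau>" using strict_mono_compose[OF s r] by (simp add: \<tau>_def[abs_def])
  have \<tau>_top: "filterlim \<tau> at_top sequentially" by (rule filterlim_subseq[OF \<tau>])
  have lim: "(\<lambda>n. (\<Sum>t=1..\<tau> n. integral\<^sup>L (law t) h) / real (\<tau> n)) \<longlonglongrightarrow> integral\<^sup>L \<mu> h"
    if h: "continuous_on UNIV h" and B: "\<And>x. \<bar>h x\<bar> \<le> B" for h :: "'b \<Rightarrow> real" and B
  proof -
    have [measurable]: "h \<in> borel_measurable borel" using h by (rule borel_measurable_continuous_onI)
    have "\<forall>\<^sub>F n in sequentially. integral\<^sup>L (cesaro_measure law (\<tau> n)) h =
        (\<Sum>t=1..\<tau> n. integral\<^sup>L (law t) h) / real (\<tau> n)"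
      using eventually_compose_filterlim[OF eventually_gt_at_top[of 0] \<tau>_top]
      by eventually_elim (rule integral_cesaro_measure[OF law sets_law _ B], auto)
    with conv[OF h B, folded \<tau>_def] show ?thesis by (rule Lim_transform_eventually)
  qed
  have "distr (\<mu> \<Otimes>\<^sub>M D) borel (\<lambda>(x, \<xi>). \<Phi> x \<xi>) = \<mu>"
  proof (rule measure_eqI_continuous)
    show "prob_space (distr (\<mu> \<Otimes>\<^sub>M D) borel (\<lambda>(x, \<xi>). \<Phi> x \<xi>))"
      by (rule P.prob_space_distr) measurable
    fix h :: "'b \<Rightarrow> real" assume h: "continuous_on UNIV h" and h01: "\<And>x. h x \<in> {0..1}"
    have hB: "\<bar>h x\<bar> \<le> 1" for x using h01[of x] by auto
    have [measurable]: "h \<in> borel_measurable borel" using h by (rule borel_measurable_continuous_onI)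
    define U where "U x = (\<integral>\<xi>. h (\<Phi> x \<xi>) \<partial>D)" for x
    have [measurable]: "U \<in> borel_measurable borel" unfolding U_def by measurable
    \<comment> \<open>Feller property by dominated convergence; continuity for almost every noise
      value suffices.\<close>
    have U_cont: "continuous_on K U"
      unfolding continuous_on_sequentially
    proof (intro allI ballI impI, unfold o_def, elim conjE)
      fix x :: "nat \<Rightarrow> 'b" and a assume "a \<in> K" "\<forall>n. x n \<in> K" "x \<longlonglongrightarrow> a"
      hence "AE \<xi> in D. (\<lambda>n. h (\<Phi> (x n) \<xi>)) \<longlonglongrightarrow> h (\<Phi> a \<xi>)"
        using cont
      proof (elim eventually_mono)
        fix \<xi> assume "continuous_on K (\<lambda>x. \<Phi> x \<xi>)"
        hence "continuous_on K (\<lambda>x. h (\<Phi> x \<xi>))" by (rule continuous_on_compose2[OF h]) auto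
        thus "(\<lambda>n. h (\<Phi> (x n) \<xi>)) \<longlonglongrightarrow> h (\<Phi> a \<xi>)"
          using \<open>a \<in> K\<close> \<open>\<forall>n. x n \<in> K\<close> \<open>x \<longlonglongrightarrow> a\<close> by (auto simp: continuous_on_sequentially o_def)
      qed
      thus "(\<lambda>n. U (x n)) \<longlonglongrightarrow> U a"
        unfolding U_def using hB by (intro integral_dominated_convergence[where w = "\<lambda>_. 1"]) auto
    qed
    have "\<bar>U x\<bar> \<le> 1" for x
      unfolding U_def using hB by (intro D.abs_expectation_le) measurable
    \<comment> \<open>\<open>U\<close> is continuous only on \<open>K\<close>, whereas
      \<open>lim\<close> asks for continuity everywhere. The Tietze extension keeps the bound and
      has the same integrals, all measures involved being carried by \<open>K\<close>.\<close>
    then obtain g where g: "continuous_on UNIV g" "\<And>x. x \<in> K \<Longrightarrow> g x = U x" "\<And>x. \<bar>g x\<bar> \<le> 1"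
      using Tietze[of K U UNIV 1] U_cont K by (auto simp: compact_imp_closed)
    have [measurable]: "g \<in> borel_measurable borel" using g(1) by (rule borel_measurable_continuous_onI)
    have gU: "integral\<^sup>L M g = integral\<^sup>L M U" if "AE x in M. x \<in> K" and [measurable_cong]: "sets M = sets borel" for M
      using that(1) g(2) by (intro integral_cong_AE) auto
    define c where "c t = integral\<^sup>L (law t) h" for t
    have c01: "\<bar>c t\<bar> \<le> 1" for t
      unfolding c_def using hB by (intro prob_space.abs_expectation_le law) measurable
    have c_Suc: "integral\<^sup>L (law t) g = c (Suc t)" for t
      unfolding c_def law_Suc gU[OF law_K sets_law] U_def
      by (rule integral_distr_step[symmetric, where B = 1]) (auto simp: law D sets_law hB)
    have "(\<lambda>n. (\<Sum>t=1..\<tau> n. c (Suc t)) / real (\<tau> n) - (\<Sum>t=1..\<tau> n. c t) / real (\<tau> n)) \<longlonglongrightarrow> 0"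
    proof (rule Lim_null_comparison)
      \<comment> \<open>This includes \<open>T = 0\<close>, where division by zero makes both sides
        0.\<close>
      have "\<bar>(\<Sum>t=1..T. c (Suc t)) / real T - (\<Sum>t=1..T. c t) / real T\<bar> \<le> 2 / real T" for T
      proof -
        have "(\<Sum>t=1..T. c (Suc t)) - (\<Sum>t=1..T. c t) = c (Suc T) - c 1"
          by (induction T) auto
        hence "(\<Sum>t=1..T. c (Suc t)) / real T - (\<Sum>t=1..T. c t) / real T = (c (Suc T) - c 1) / real T"
          by (metis diff_divide_distrib)
        moreover have "\<bar>c (Suc T) - c 1\<bar> \<le> 2" using c01[of "Suc T"] c01[of 1] by linarith
        ultimately show ?thesis by (simp add: divide_right_mono)
      qed
      thus "\<forall>\<^sub>F n in sequentially.
          norm ((\<Sum>t=1..\<tau> n. c (Suc t)) / real (\<tau> n) - (\<Sum>t=1..\<tau> n. c t) / real (\<tau> n)) \<le> 2 / real (\<tau> n)"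
        by simp
      show "(\<lambda>n. 2 / real (\<tau> n)) \<longlonglongrightarrow> 0"
        by (intro tendsto_divide_0[OF tendsto_const] filterlim_at_top_imp_at_infinity
            filterlim_compose[OF filterlim_real_sequentially \<tau>_top])
    qed
    moreover have "(\<lambda>n. (\<Sum>t=1..\<tau> n. c (Suc t)) / real (\<tau> n) - (\<Sum>t=1..\<tau> n. c t) / real (\<tau> n))
        \<longlonglongrightarrow> integral\<^sup>L \<mu> g - integral\<^sup>L \<mu> h"
      using lim[OF g(1,3)] lim[OF h hB] unfolding c_Suc c_def[symmetric] by (rule tendsto_diff)
    ultimately have "integral\<^sup>L \<mu> g = integral\<^sup>L \<mu> h"
      using LIMSEQ_unique by fastforce
    moreover have "integral\<^sup>L \<mu> U = integral\<^sup>L (distr (\<mu> \<Otimes>\<^sub>M D) borel (\<lambda>(x, \<xi>). \<Phi> x \<xi>)) h"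
      unfolding U_def by (rule integral_distr_step[symmetric, where B = 1]) (auto simp: \<mu> D sets_\<mu> hB)
    ultimately show "integral\<^sup>L (distr (\<mu> \<Otimes>\<^sub>M D) borel (\<lambda>(x, \<xi>). \<Phi> x \<xi>)) h = integral\<^sup>L \<mu> h"
      using gU[OF \<mu>_K sets_\<mu>] by simp
  qed (simp_all add: \<mu> sets_\<mu>)
  thus thesis using that[OF r \<mu> sets_\<mu> \<mu>_K] lim[unfolded \<tau>_def] by blast
qed

section \<open>The law of a geometric opinion dynamics\<close>

text \<open>The recursion consumes the newest noise last; here the oldest noise is absorbed into the
  starting point.\<close>

lemma god_traj_case_nat: "god_traj f x (Suc t) (case_nat \<xi> \<omega>) = god_traj f (god_step f x \<xi>) t \<omega>"
  by (induction t) simp_all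

text \<open>Measurability holds on the whole space, also where the vector to be normalized vanishes,
  since \<open>inverse 0 = 0\<close> is still a Borel convention.\<close>

lemma god_step_measurable:
  fixes f :: "'n::finite \<Rightarrow> ('a::euclidean_space ^ 'n) \<Rightarrow> 'a \<Rightarrow> 'a"
  assumes f: "\<And>i. (\<lambda>(x, \<xi>). f i x \<xi>) \<in> borel_measurable (borel \<Otimes>\<^sub>M borel)"
  shows "(\<lambda>(x, \<xi>). god_step f x \<xi>) \<in> borel_measurable (borel \<Otimes>\<^sub>M borel)"
proof -
  have nth: "(\<lambda>p. fst p $ i) \<in> borel_measurable ((borel :: ('a ^ 'n) measure) \<Otimes>\<^sub>M (borel :: 'a measure))" for i :: 'n
  proof (rule measurable_compose[OF measurable_fst])
    show "(\<lambda>x :: 'a ^ 'n. x $ i) \<in> borel_measurable borel"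
      by (intro borel_measurable_continuous_onI continuous_intros)
  qed
  have [measurable]: "(\<lambda>p. fst p $ i + f i (fst p) (snd p)) \<in> borel_measurable (borel \<Otimes>\<^sub>M borel)" for i
    using nth f[of i] by (simp add: case_prod_unfold)
  show ?thesis
    unfolding case_prod_unfold
  proof (subst borel_measurable_euclidean_space, rule ballI)
    fix b :: "'a ^ 'n" assume "b \<in> Basis"
    then obtain i u where b: "b = axis i u" by (auto simp: Basis_vec_def)
    show "(\<lambda>p. god_step f (fst p) (snd p) \<bullet> b) \<in> borel_measurable (borel \<Otimes>\<^sub>M borel)"
      unfolding b inner_axis god_step_def vec_lambda_beta by measurable
  qed
qed

context
  fixes f :: "'n::finite \<Rightarrow> ('a::euclidean_space ^ 'n) \<Rightarrow> 'a \<Rightarrow> 'a" and D :: "'a measure"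
  assumes D: "prob_space D"
    and step [measurable]: "(\<lambda>(x, \<xi>). god_step f x \<xi>) \<in> borel_measurable (borel \<Otimes>\<^sub>M D)"
begin

lemma god_traj_measurable: "god_traj f x t \<in> borel_measurable (PiM UNIV (\<lambda>_. D))"
proof (induction t)
  case (Suc t)
  note [measurable] = Suc
  have "(\<lambda>\<omega>. case (god_traj f x t \<omega>, \<omega> t) of (x, \<xi>) \<Rightarrow> god_step f x \<xi>) \<in> borel_measurable (PiM UNIV (\<lambda>_. D))"
    by measurable
  thus ?case by simp
qed simp

text \<open>Splitting off the first noise variable instead of the last one avoids proving independence of
  \<open>\<omega> t\<close> and the state at time \<open>t\<close>.\<close>

lemma nn_integral_god_traj_Suc:
  assumes [measurable]: "g \<in> borel_measurable borel"
  shows "(\<integral>\<^sup>+\<omega>. g (god_traj f x (Suc t) \<omega>) \<partial>PiM UNIV (\<lambda>_. D)) =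
    (\<integral>\<^sup>+\<omega>. (\<integral>\<^sup>+\<xi>. g (god_step f (god_traj f x t \<omega>) \<xi>) \<partial>D) \<partial>PiM UNIV (\<lambda>_. D))"
proof -
  interpret D: prob_space D by (rule D)
  interpret S: sequence_space D ..
  note god_traj_measurable [measurable]
  \<comment> \<open>A noise sequence is one draw from \<open>D\<close> followed by an independent
    noise sequence. Nonnegative integrals spare integrability conditions in Fubini.\<close>
  have split: "(\<integral>\<^sup>+\<omega>. G (god_traj f x (Suc t) \<omega>) \<partial>S.S) =
      (\<integral>\<^sup>+\<xi>. (\<integral>\<^sup>+\<omega>. G (god_traj f (god_step f x \<xi>) t \<omega>) \<partial>S.S) \<partial>D)"
    if [measurable]: "G \<in> borel_measurable borel" for G x t
  proof -
    have "(\<integral>\<^sup>+\<omega>. G (god_traj f x (Suc t) \<omega>) \<partial>S.S) =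
        (\<integral>\<^sup>+\<omega>. G (god_traj f x (Suc t) \<omega>) \<partial>distr (D \<Otimes>\<^sub>M S.S) S.S (\<lambda>(\<xi>, \<omega>). case_nat \<xi> \<omega>))"
      unfolding S.PiM_iter ..
    also have "\<dots> = (\<integral>\<^sup>+p. G (god_traj f x (Suc t) (case_nat (fst p) (snd p))) \<partial>(D \<Otimes>\<^sub>M S.S))"
      by (subst nn_integral_distr) (auto simp: case_prod_unfold simp del: god_traj.simps)
    also have "\<dots> = (\<integral>\<^sup>+\<xi>. (\<integral>\<^sup>+\<omega>. G (god_traj f x (Suc t) (case_nat \<xi> \<omega>)) \<partial>S.S) \<partial>D)"
      by (subst S.P.nn_integral_fst[symmetric]) (auto simp del: god_traj.simps)
    finally show ?thesis unfolding god_traj_case_nat .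
  qed
  show ?thesis
  \<comment> \<open>The start must vary because splitting moves it by one random step. The step case
    then applies \<open>split\<close> backwards to the inner integral over the last noise.\<close>
  proof (induction t arbitrary: x)
    case 0
    show ?case
      using split[OF assms, of x 0] S.P.emeasure_space_1 by simp
  next
    case (Suc t)
    have "(\<integral>\<^sup>+\<omega>. g (god_traj f x (Suc (Suc t)) \<omega>) \<partial>S.S) =
        (\<integral>\<^sup>+\<xi>. (\<integral>\<^sup>+\<omega>. (\<integral>\<^sup>+\<zeta>. g (god_step f (god_traj f (god_step f x \<xi>) t \<omega>) \<zeta>) \<partial>D) \<partial>S.S) \<partial>D)"
      unfolding split[OF assms, of x "Suc t"] Suc.IH ..
    also have "\<dots> = (\<integral>\<^sup>+\<omega>. (\<integral>\<^sup>+\<zeta>. g (god_step f (god_traj f x (Suc t) \<omega>) \<zeta>) \<partial>D) \<partial>S.S)"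
      by (rule split[symmetric]) measurable
    finally show ?case .
  qed
qed

text \<open>Independence of the current state and the next noise, in the product form used by
  \<open>god_invariant\<close>.\<close>

lemma distr_god_traj_Suc:
  "distr (PiM UNIV (\<lambda>_. D)) borel (god_traj f x (Suc t)) =
   distr (distr (PiM UNIV (\<lambda>_. D)) borel (god_traj f x t) \<Otimes>\<^sub>M D) borel (\<lambda>(x, \<xi>). god_step f x \<xi>)"
  (is "?L = distr (?M \<Otimes>\<^sub>M D) borel _")
proof (rule measure_eqI)
  interpret D: prob_space D by (rule D)
  note god_traj_measurable [measurable]
  fix A assume "A \<in> sets ?L"
  hence [measurable]: "A \<in> sets borel" by simp
  have "emeasure ?L A = (\<integral>\<^sup>+\<omega>. indicator A (god_traj f x (Suc t) \<omega>) \<partial>PiM UNIV (\<lambda>_. D))"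
    by (subst nn_integral_indicator[symmetric], simp, subst nn_integral_distr)
       (auto simp del: god_traj.simps)
  also have "\<dots> = (\<integral>\<^sup>+\<omega>. (\<integral>\<^sup>+\<xi>. indicator A (god_step f (god_traj f x t \<omega>) \<xi>) \<partial>D) \<partial>PiM UNIV (\<lambda>_. D))"
    by (rule nn_integral_god_traj_Suc) measurable
  also have "\<dots> = (\<integral>\<^sup>+y. (\<integral>\<^sup>+\<xi>. indicator A (god_step f y \<xi>) \<partial>D) \<partial>?M)"
    by (subst nn_integral_distr) auto
  also have "\<dots> = (\<integral>\<^sup>+p. indicator A (god_step f (fst p) (snd p)) \<partial>(?M \<Otimes>\<^sub>M D))"
    by (subst D.nn_integral_fst[symmetric]) auto
  also have "\<dots> = emeasure (distr (?M \<Otimes>\<^sub>M D) borel (\<lambda>(x, \<xi>). god_step f x \<xi>)) A"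
    by (subst nn_integral_indicator[symmetric], simp, subst nn_integral_distr)
       (auto simp: case_prod_unfold)
  finally show "emeasure ?L A = \<dots>" .
qed simp

end

section \<open>The configuration space and the convergence of time averages\<close>

lemma compact_config_space: "compact (config_space :: ('a::euclidean_space ^ 'n::finite) set)"
proof -
  have "closed (config_space :: ('a ^ 'n) set)"
    unfolding config_space_def mem_sphere
    by (intro closed_Collect_all closed_Collect_eq continuous_intros)
  moreover have "norm x \<le> real CARD('n)" if "x \<in> config_space" for x :: "'a ^ 'n"
  proof -
    have "norm x \<le> (\<Sum>i\<in>UNIV. norm (x $ i))"
      unfolding norm_vec_def by (rule L2_set_le_sum) simp
    thus ?thesis using that by (simp add: config_space_def)
  qed
  ultimately show ?thesis by (auto simp: compact_eq_bounded_closed bounded_iff)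
qed

lemma god_step_in_config_space:
  assumes "\<And>i. x $ i + f i x \<xi> \<noteq> 0"
  shows "god_step f x \<xi> \<in> config_space"
  using assms by (simp add: config_space_def god_step_def)

lemma continuous_on_god_step:
  assumes "\<And>i. continuous_on S (\<lambda>x. f i x \<xi>)" "\<And>i x. x \<in> S \<Longrightarrow> x $ i + f i x \<xi> \<noteq> 0"
  shows "continuous_on S (\<lambda>x. god_step f x \<xi>)"
  unfolding god_step_def by (intro continuous_intros assms) (use assms(2) in auto)

theorem theorem4p6:
  fixes f :: "'n::finite \<Rightarrow> ('a::euclidean_space ^ 'n) \<Rightarrow> 'a \<Rightarrow> 'a"
    and D :: "'a measure"
  assumes D_prob: "prob_space D"
    and D_sets: "sets D = sets borel"
    and D_sphere: "emeasure D (sphere 0 1) = 1"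
    and f_meas: "\<And>i. (\<lambda>(x, \<xi>). f i x \<xi>) \<in> borel_measurable (borel \<Otimes>\<^sub>M borel)"
    and f_nonzero: "\<And>i x \<xi>. x \<in> config_space \<Longrightarrow> \<xi> \<in> sphere 0 1 \<Longrightarrow> x $ i + f i x \<xi> \<noteq> 0"
    and f_cont: "\<And>i \<xi>. \<xi> \<in> sphere 0 1 \<Longrightarrow> continuous_on config_space (\<lambda>x. f i x \<xi>)"
    and inv_supp: "\<And>\<mu>. god_invariant f D \<mu> \<Longrightarrow> measure_support \<mu> \<subseteq> polarized"
    and x0: "x0 \<in> config_space"
    and eps: "\<epsilon> > 0"
  shows "(\<lambda>T. (1 / real T) *
            (\<integral>\<omega>. (\<Sum>t = 1..T. indicator (polarized_eps \<epsilon>) (god_traj f x0 t \<omega>))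
               \<partial>(PiM UNIV (\<lambda>_::nat. D))))
         \<longlonglongrightarrow> 1"
proof (rule ccontr)
  let ?S = "PiM UNIV (\<lambda>_::nat. D)" and ?K = "config_space :: ('a ^ 'n) set"
  let ?P = "polarized :: ('a ^ 'n) set"
  define a where "a T = (1 / real T) *
    (\<integral>\<omega>. (\<Sum>t = 1..T. indicator (polarized_eps \<epsilon>) (god_traj f x0 t \<omega>)) \<partial>?S)" for T
  assume "\<not> ?thesis"
  hence "\<not> a \<longlonglongrightarrow> 1" by (simp add: a_def[abs_def])
  then obtain \<delta> where \<delta>: "\<delta> > 0" "infinite {T. \<not> dist (a T) 1 < \<delta>}"
    by (auto simp: tendsto_iff not_eventually INFM_iff_infinite cofinite_eq_sequentially[symmetric])
  then obtain s :: "nat \<Rightarrow> nat" where s: "strict_mono s" "\<And>n. \<not> dist (a (s n)) 1 < \<delta>"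
    using infinite_enumerate[OF \<delta>(2)] by auto
  interpret D: prob_space D by (rule D_prob)
  interpret S: sequence_space D ..
  have [measurable_cong]: "sets D = sets borel" by (rule D_sets)
  have step: "(\<lambda>(x, \<xi>). god_step f x \<xi>) \<in> borel_measurable (borel \<Otimes>\<^sub>M D)"
    using god_step_measurable[OF f_meas] by (simp cong: measurable_cong_sets add: sets_pair_measure_cong[OF refl D_sets])
  note traj [measurable] = god_traj_measurable[OF D_prob step]
  have [measurable]: "?K \<in> sets borel"
    by (intro borel_closed compact_imp_closed compact_config_space)
  have "closed (polarized_eps \<epsilon> :: ('a ^ 'n) set)"
    unfolding polarized_eps_def
    by (intro closed_Collect_conj closed_Collect_le continuous_intros)
       (simp add: compact_imp_closed compact_config_space)
  hence [measurable]: "(polarized_eps \<epsilon> :: ('a ^ 'n) set) \<in> sets borel" by (rule borel_closed)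
  have D_AE: "AE \<xi> in D. \<xi> \<in> sphere 0 1"
    using D_sphere by (intro D.AE_prob_1) (simp add: D.emeasure_eq_measure)
  define law where "law t = distr ?S borel (god_traj f x0 t)" for t
  have law: "prob_space (law t)" for t
    unfolding law_def by (intro S.P.prob_space_distr traj)
  \<comment> \<open>The step is known to stay in the configuration space only for noise on the
    sphere; countably many times share one null set.\<close>
  have "AE \<omega> in ?S. \<forall>t. \<omega> t \<in> sphere 0 1"
    by (subst AE_all_countable) (intro allI AE_PiM_component D_AE D_prob UNIV_I)
  hence traj_K: "AE \<omega> in ?S. \<forall>t. god_traj f x0 t \<omega> \<in> ?K"
  proof eventually_elim
    case (elim \<omega>)
    have "god_traj f x0 t \<omega> \<in> ?K" for t
      by (induction t) (use x0 elim f_nonzero in \<open>auto intro!: god_step_in_config_space\<close>)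
    thus ?case ..
  qed
  have law_K: "AE x in law t. x \<in> ?K" for t
    unfolding law_def using traj_K by (subst AE_distr_iff) auto
  have cont: "AE \<xi> in D. continuous_on ?K (\<lambda>x. god_step f x \<xi>)"
    using D_AE by eventually_elim (intro continuous_on_god_step f_cont f_nonzero)
  have law_Suc: "law (Suc t) = distr (law t \<Otimes>\<^sub>M D) borel (\<lambda>(x, \<xi>). god_step f x \<xi>)" for t
    unfolding law_def by (rule distr_god_traj_Suc[OF D_prob step])
  have sets_law: "sets (law t) = sets borel" for t by (simp add: law_def)
  obtain r \<mu> where r: "strict_mono (r :: nat \<Rightarrow> nat)"
    and \<mu>: "prob_space \<mu>" "sets \<mu> = sets borel" "AE x in \<mu>. x \<in> ?K"
      "distr (\<mu> \<Otimes>\<^sub>M D) borel (\<lambda>(x, \<xi>). god_step f x \<xi>) = \<mu>"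
    and conv: "\<And>(h :: 'a ^ 'n \<Rightarrow> real) B. continuous_on UNIV h \<Longrightarrow> (\<And>x. \<bar>h x\<bar> \<le> B) \<Longrightarrow>
       (\<lambda>n. (\<Sum>t=1..s (r n). integral\<^sup>L (law t) h) / real (s (r n))) \<longlonglongrightarrow> integral\<^sup>L \<mu> h"
    using krylov_bogoliubov[where \<Phi> = "god_step f" and law = law,
        OF compact_config_space D_prob step cont law sets_law law_K law_Suc s(1)] by blast
  note [measurable_cong] = \<mu>(2)
  interpret \<mu>: prob_space \<mu> by fact
  have "god_invariant f D \<mu>"
    using \<mu> \<mu>.emeasure_eq_1_AE[of ?K] by (simp add: god_invariant_def)
  hence "measure_support \<mu> \<subseteq> polarized" by (rule inv_supp)
  hence \<mu>_P: "AE x in \<mu>. x \<in> polarized"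
    using AE_measure_support[OF \<mu>(2)] by (auto elim: eventually_mono)
  define h where "h x = min 1 (infdist x ?P / \<epsilon>)" for x
  have h_cont: "continuous_on UNIV h"
    unfolding h_def using eps by (intro continuous_intros) auto
  hence [measurable]: "h \<in> borel_measurable borel" by (rule borel_measurable_continuous_onI)
  have h_nonneg: "h x \<ge> 0" for x using eps infdist_nonneg[of x ?P] by (simp add: h_def)
  have h_bound: "\<bar>h x\<bar> \<le> 1" for x using h_nonneg[of x] by (simp add: h_def)
  have "integral\<^sup>L \<mu> h = (\<integral>x. 0 \<partial>\<mu>)"
    using \<mu>_P by (intro integral_cong_AE) (auto simp: h_def)
  hence lim0: "(\<lambda>n. (\<Sum>t=1..s (r n). integral\<^sup>L (law t) h) / real (s (r n))) \<longlonglongrightarrow> 0"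
    using conv[OF h_cont h_bound] by simp
  define b where "b t = measure (law t) (polarized_eps \<epsilon>)" for t
  have a_b: "a T = (\<Sum>t=1..T. b t) / real T" for T
  proof -
    have "(\<integral>\<omega>. (\<Sum>t = 1..T. indicat_real (polarized_eps \<epsilon>) (god_traj f x0 t \<omega>)) \<partial>?S) =
        (\<Sum>t=1..T. (\<integral>\<omega>. indicat_real (polarized_eps \<epsilon>) (god_traj f x0 t \<omega>) \<partial>?S))"
      by (intro Bochner_Integration.integral_sum S.P.integrable_const_bound[where B = 1]) auto
    also have "\<dots> = (\<Sum>t=1..T. b t)"
    proof (intro sum.cong refl)
      fix t
      have "(\<integral>\<omega>. indicat_real (polarized_eps \<epsilon>) (god_traj f x0 t \<omega>) \<partial>?S) =
          integral\<^sup>L (law t) (indicat_real (polarized_eps \<epsilon>))"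
        unfolding law_def by (rule integral_distr[symmetric]) auto
      thus "(\<integral>\<omega>. indicat_real (polarized_eps \<epsilon>) (god_traj f x0 t \<omega>) \<partial>?S) = b t"
        by (simp add: b_def law_def)
    qed
    finally show ?thesis by (simp add: a_def)
  qed
  have b_bounds: "b t \<le> 1" "1 - integral\<^sup>L (law t) h \<le> b t" for t
  proof -
    interpret L: prob_space "law t" by (rule law)
    have [measurable_cong]: "sets (law t) = sets borel" by (simp add: law_def)
    have int: "integrable (law t) h"
      by (rule L.integrable_const_bound[where B = 1]) (auto simp: h_bound)
    show "b t \<le> 1" by (simp add: b_def)
    have "(\<integral>x. 1 - h x \<partial>law t) \<le> integral\<^sup>L (law t) (indicat_real (polarized_eps \<epsilon>))"
    proof (rule integral_mono_AE)
      \<comment> \<open>At distance more than \<open>\<epsilon>\<close> from the polarized set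
        \<open>h\<close> is 1. Points must lie in the configuration space, since
        \<open>polarized_eps\<close> is cut down to it.\<close>
      show "AE x in law t. 1 - h x \<le> indicat_real (polarized_eps \<epsilon>) x"
        using law_K[of t]
      proof eventually_elim
        case (elim x)
        thus ?case
          using eps h_nonneg[of x] by (auto simp: indicator_def polarized_eps_def h_def min_def field_simps)
      qed
    qed (use int in \<open>auto intro!: L.integrable_const_bound[where B = 1]\<close>)
    moreover have "(\<integral>x. 1 - h x \<partial>law t) = 1 - integral\<^sup>L (law t) h"
      using int by (simp add: L.prob_space)
    ultimately show "1 - integral\<^sup>L (law t) h \<le> b t"
      by (simp add: b_def law_def)
  qed
  \<comment> \<open>The lower bound fails at \<open>T = 0\<close>, where \<open>a 0 = 0\<close> but
    the left side is 1.\<close>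
  have a_bounds: "a T \<le> 1" "T > 0 \<Longrightarrow> 1 - (\<Sum>t=1..T. integral\<^sup>L (law t) h) / real T \<le> a T" for T
  proof -
    have "(\<Sum>t=1..T. b t) \<le> (\<Sum>t=1..T. 1)" by (intro sum_mono b_bounds)
    thus "a T \<le> 1" by (simp add: a_b divide_le_eq)
    have "(\<Sum>t=1..T. 1 - integral\<^sup>L (law t) h) \<le> (\<Sum>t=1..T. b t)" by (intro sum_mono b_bounds)
    hence "(\<Sum>t=1..T. 1 - integral\<^sup>L (law t) h) / real T \<le> (\<Sum>t=1..T. b t) / real T"
      by (intro divide_right_mono) auto
    thus "1 - (\<Sum>t=1..T. integral\<^sup>L (law t) h) / real T \<le> a T" if "T > 0"
      using that by (simp add: a_b sum_subtractf diff_divide_distrib)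
  qed
  have sr: "strict_mono (s \<circ> r)" using s(1) r by (rule strict_mono_o)
  have "(\<lambda>n. a (s (r n))) \<longlonglongrightarrow> 1"
  proof (rule tendsto_sandwich)
    show "(\<lambda>n. 1 - (\<Sum>t=1..s (r n). integral\<^sup>L (law t) h) / real (s (r n))) \<longlonglongrightarrow> 1"
      using tendsto_diff[OF tendsto_const lim0, of 1] by simp
    show "\<forall>\<^sub>F n in sequentially. 1 - (\<Sum>t=1..s (r n). integral\<^sup>L (law t) h) / real (s (r n)) \<le> a (s (r n))"
      using eventually_compose_filterlim[OF eventually_gt_at_top[of 0] filterlim_subseq[OF sr]]
      by eventually_elim (rule a_bounds(2), simp)
  qed (auto simp: a_bounds)
  hence "\<forall>\<^sub>F n in sequentially. dist (a (s (r n))) 1 < \<delta>" using \<delta>(1) by (rule tendstoD)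
  thus False using s(2) by simp
qed

end
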